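(* Let $F\dashv U$, $F\colon\mathcal A\to\mathcal B$, be an adjunction with unit $\eta$ and counit $\epsilon$, with induced comonad $\mathbb T=(FU,F\eta U,\epsilon)$ on $\mathcal B$. Let $\mathbb C=(C,\Delta^C,\varepsilon^C)$ be a comonad on $\mathcal A$, $\mathbb S=(S,\Delta^S,\varepsilon^S)$ a comonad on $\mathcal B$, and $\Omega\colon CU\to US$ a natural isomorphism that is a lax morphism of comonads. Let $\chi\colon\mathbb T\mathbb S\to\mathbb S\mathbb T$ be the comonad distributive law determined by $\Omega$. Let $M\colon\mathcal Y\to\mathcal B$ be a functor. (1) Right $\chi$-coalgebra structures $\rho$ on $M$ correspond to $\mathbb C$-coalgebra structures $\nabla$ on the functor $UM\colon\mathcal Y\to\mathcal A$. (2) Let $S$ and $V$ be two lifts of the functor $C$ through the adjunction (with comonads $\mathbb S,\mathbb V$ on $\mathcal B$ and natural isomorphisms $\Omega\colon CU\to US$, $\Phi\colon CU\to UV$ that are lax morphisms of comonads), and let $\chi^S$ and $\chi^V$ denote the comonad distributive laws determined by the lifts $S$ and $V$ respectively. Then the Galois map $\Gamma^{S,V}$ maps right $\chi^S$-coalgebra structures $\rho^S$ on $M$ bijectively to right $\chi^V$-coalgebra structures $\rho^V$ on $M$.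
   Context: Juxtaposition denotes composition of functors and whiskering. Write $T=FU$. $\Omega\colon CU\to US$ is a lax morphism of comonads if $U\varepsilon^S\circ\Omega=\varepsilon^CU$ and $U\Delta^S\circ\Omega=\Omega S\circ C\Omega\circ\Delta^CU$. The distributive law determined by $\Omega$ is $\chi=\chi^S:=\Lambda U\circ F\Omega^{-1}\colon TS=FUS\to SFU=ST$, where $\Lambda\colon FC\to SF$ corresponds under the adjunction to $\Omega F\circ C\eta\colon C\to USF$ (this $\chi$ is a comonad distributive law). $\chi^V$ is obtained in the same way from $\Phi$. A right $\chi$-coalgebra structure on $M\colon\mathcal Y\to\mathcal B$ is a natural transformation $\rho\colon TM\to SM$ with $\varepsilon^SM\circ\rho=\epsilon M$ and $\Delta^SM\circ\rho=S\rho\circ\chi M\circ T\rho\circ\Delta^TM$, where $\Delta^T=F\eta U$ is the comultiplication of $\mathbb T$. A $\mathbb C$-coalgebra structure on a functor $P\colon\mathcal Y\to\mathcal A$ is a natural transformation $\nabla\colon P\to CP$ with $\Delta^CP\circ\nabla=C\nabla\circ\nabla$ and $\varepsilon^CP\circ\nabla=\mathrm{id}$. The Galois map $\Gamma^{S,V}\colon\mathcal B(F-,S-)\to\mathcal B(F-,V-)$ is given in components by $\mathcal B(FX,SY)\cong\mathcal A(X,USY)\to\mathcal A(X,UVY)\cong\mathcal B(FX,VY)$, the outer bijections being those of the adjunction and the middle map being postcomposition with $\Phi_Y\circ\Omega_Y^{-1}$; it is applied componentwise to $\rho^S\colon FUM\to SM$ (with $X=UMy$, $Y=My$ for objects $y$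 of $\mathcal Y$). *)

theory Defs
  imports Main "HOL-Library.FuncSet"
begin

record ('o, 'm) cat =
  Obj   :: "'o set"
  Arr   :: "'m set"
  Dom   :: "'m \<Rightarrow> 'o"
  Cod   :: "'m \<Rightarrow> 'o"
  Ident :: "'o \<Rightarrow> 'm"
  Comp  :: "'m \<Rightarrow> 'm \<Rightarrow> 'm"  (infixl "\<cdot>\<index>" 70)

definition hom :: "('o, 'm) cat \<Rightarrow> 'o \<Rightarrow> 'o \<Rightarrow> 'm set" where
  "hom A X Y = {f \<in> Arr A. Dom A f = X \<and> Cod A f = Y}"

locale category =
  fixes A :: "('o, 'm) cat" (structure)
  assumes Dom_Obj: "f \<in> Arr A \<Longrightarrow> Dom A f \<in> Obj A"
    and Cod_Obj: "f \<in> Arr A \<Longrightarrow> Cod A f \<in> Obj A"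
    and Ident_hom: "X \<in> Obj A \<Longrightarrow> Ident A X \<in> hom A X X"
    and Comp_hom: "f \<in> hom A X Y \<Longrightarrow> g \<in> hom A Y Z \<Longrightarrow> g \<cdot> f \<in> hom A X Z"
    and Comp_assoc:
      "f \<in> hom A W X \<Longrightarrow> g \<in> hom A X Y \<Longrightarrow> h \<in> hom A Y Z \<Longrightarrow> (h \<cdot> g) \<cdot> f = h \<cdot> (g \<cdot> f)"
    and Comp_Ident_left: "f \<in> hom A X Y \<Longrightarrow> Ident A Y \<cdot> f = f"
    and Comp_Ident_right: "f \<in> hom A X Y \<Longrightarrow> f \<cdot> Ident A X = f"

definition inverse_arrows :: "('o, 'm) cat \<Rightarrow> 'm \<Rightarrow> 'm \<Rightarrow> bool" where
  "inverse_arrows A f g \<longleftrightarrow>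
     f \<in> Arr A \<and> g \<in> hom A (Cod A f) (Dom A f) \<and>
     g \<cdot>\<^bsub>A\<^esub> f = Ident A (Dom A f) \<and> f \<cdot>\<^bsub>A\<^esub> g = Ident A (Cod A f)"

definition iso :: "('o, 'm) cat \<Rightarrow> 'm \<Rightarrow> bool" where
  "iso A f \<longleftrightarrow> (\<exists>g. inverse_arrows A f g)"

definition inv_arr :: "('o, 'm) cat \<Rightarrow> 'm \<Rightarrow> 'm" where
  "inv_arr A f = (THE g. inverse_arrows A f g)"

record ('o1, 'm1, 'o2, 'm2) funct =
  on_obj :: "'o1 \<Rightarrow> 'o2"  (infixr "$\<^sub>o" 90)
  on_arr :: "'m1 \<Rightarrow> 'm2"  (infixr "$\<^sub>a" 90)

locale cat_functor = A: category A + B: category B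
  for A :: "('o1, 'm1) cat" and B :: "('o2, 'm2) cat" +
  fixes F :: "('o1, 'm1, 'o2, 'm2) funct"
  assumes Obj: "X \<in> Obj A \<Longrightarrow> F $\<^sub>o X \<in> Obj B"
    and hom: "f \<in> hom A X Y \<Longrightarrow> F $\<^sub>a f \<in> hom B (F $\<^sub>o X) (F $\<^sub>o Y)"
    and Ident: "X \<in> Obj A \<Longrightarrow> F $\<^sub>a Ident A X = Ident B (F $\<^sub>o X)"
    and Comp: "f \<in> hom A X Y \<Longrightarrow> g \<in> hom A Y Z \<Longrightarrow>
      F $\<^sub>a (g \<cdot>\<^bsub>A\<^esub> f) = (F $\<^sub>a g) \<cdot>\<^bsub>B\<^esub> (F $\<^sub>a f)"

definition id_funct :: "('o, 'm, 'o, 'm) funct" where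
  "id_funct = \<lparr>on_obj = (\<lambda>X. X), on_arr = (\<lambda>f. f)\<rparr>"

definition fcomp ::
  "('o2, 'm2, 'o3, 'm3) funct \<Rightarrow> ('o1, 'm1, 'o2, 'm2) funct \<Rightarrow> ('o1, 'm1, 'o3, 'm3) funct"
  (infixr "\<circ>\<^sub>F" 80) where
  "G \<circ>\<^sub>F F = \<lparr>on_obj = (\<lambda>X. G $\<^sub>o F $\<^sub>o X), on_arr = (\<lambda>f. G $\<^sub>a F $\<^sub>a f)\<rparr>"

text \<open>
  A natural transformation is its family of components. The family is required to be
  extensional (\<^const>\<open>undefined\<close> off the objects of the source), so that HOL equality of such
  families is equality of natural transformations and sets of them can be compared by bijections.
\<close>

locale nat_trans = F: cat_functor A B F + G: cat_functor A B G
  for A :: "('o1, 'm1) cat" and B :: "('o2, 'm2) cat"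
    and F :: "('o1, 'm1, 'o2, 'm2) funct" and G :: "('o1, 'm1, 'o2, 'm2) funct" +
  fixes \<tau> :: "'o1 \<Rightarrow> 'm2"
  assumes components: "\<tau> \<in> (\<Pi>\<^sub>E X \<in> Obj A. hom B (F $\<^sub>o X) (G $\<^sub>o X))"
    and naturality: "f \<in> hom A X Y \<Longrightarrow> (G $\<^sub>a f) \<cdot>\<^bsub>B\<^esub> \<tau> X = \<tau> Y \<cdot>\<^bsub>B\<^esub> (F $\<^sub>a f)"

locale nat_iso = nat_trans +
  assumes iso: "X \<in> Obj A \<Longrightarrow> iso B (\<tau> X)"

locale adjunction =
  F: cat_functor A B F + U: cat_functor B A U +
  unit: nat_trans A A id_funct "U \<circ>\<^sub>F F" \<eta> +
  counit: nat_trans B B "F \<circ>\<^sub>F U" id_funct \<epsilon>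
  for A :: "('oa, 'ma) cat" and B :: "('ob, 'mb) cat"
    and F :: "('oa, 'ma, 'ob, 'mb) funct" and U :: "('ob, 'mb, 'oa, 'ma) funct"
    and \<eta> :: "'oa \<Rightarrow> 'ma" and \<epsilon> :: "'ob \<Rightarrow> 'mb" +
  assumes triangle_left: "X \<in> Obj A \<Longrightarrow> \<epsilon> (F $\<^sub>o X) \<cdot>\<^bsub>B\<^esub> (F $\<^sub>a \<eta> X) = Ident B (F $\<^sub>o X)"
    and triangle_right: "Y \<in> Obj B \<Longrightarrow> (U $\<^sub>a \<epsilon> Y) \<cdot>\<^bsub>A\<^esub> \<eta> (U $\<^sub>o Y) = Ident A (U $\<^sub>o Y)"

text \<open>
  The two directions of the bijection B(FX,Y) = A(X,UY) of an adjunction. The first depends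
  on the object X, the second on the object Y.
\<close>

definition to_right ::
  "('oa, 'ma) cat \<Rightarrow> ('ob, 'mb, 'oa, 'ma) funct \<Rightarrow> ('oa \<Rightarrow> 'ma) \<Rightarrow> 'oa \<Rightarrow> 'mb \<Rightarrow> 'ma" where
  "to_right A U \<eta> X f = (U $\<^sub>a f) \<cdot>\<^bsub>A\<^esub> \<eta> X"

definition to_left ::
  "('ob, 'mb) cat \<Rightarrow> ('oa, 'ma, 'ob, 'mb) funct \<Rightarrow> ('ob \<Rightarrow> 'mb) \<Rightarrow> 'ob \<Rightarrow> 'ma \<Rightarrow> 'mb" where
  "to_left B F \<epsilon> Y g = \<epsilon> Y \<cdot>\<^bsub>B\<^esub> (F $\<^sub>a g)"

record ('o, 'm) comonad_data =
  endo   :: "('o, 'm, 'o, 'm) funct"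
  comult :: "'o \<Rightarrow> 'm"
  coun   :: "'o \<Rightarrow> 'm"

locale comonad =
  endo: cat_functor A A "endo K" +
  comult: nat_trans A A "endo K" "endo K \<circ>\<^sub>F endo K" "comult K" +
  coun: nat_trans A A "endo K" id_funct "coun K"
  for A :: "('o, 'm) cat" and K :: "('o, 'm) comonad_data" +
  assumes coassoc: "X \<in> Obj A \<Longrightarrow>
      comult K (endo K $\<^sub>o X) \<cdot>\<^bsub>A\<^esub> comult K X = (endo K $\<^sub>a comult K X) \<cdot>\<^bsub>A\<^esub> comult K X"
    and coun_left: "X \<in> Obj A \<Longrightarrow>
      coun K (endo K $\<^sub>o X) \<cdot>\<^bsub>A\<^esub> comult K X = Ident A (endo K $\<^sub>o X)"
    and coun_right: "X \<in> Obj A \<Longrightarrow>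
      (endo K $\<^sub>a coun K X) \<cdot>\<^bsub>A\<^esub> comult K X = Ident A (endo K $\<^sub>o X)"

definition induced_comonad ::
  "('ob, 'mb) cat \<Rightarrow> ('oa, 'ma, 'ob, 'mb) funct \<Rightarrow> ('ob, 'mb, 'oa, 'ma) funct \<Rightarrow>
    ('oa \<Rightarrow> 'ma) \<Rightarrow> ('ob \<Rightarrow> 'mb) \<Rightarrow> ('ob, 'mb) comonad_data" where
  "induced_comonad B F U \<eta> \<epsilon> =
     \<lparr>endo = F \<circ>\<^sub>F U, comult = (\<lambda>Y \<in> Obj B. F $\<^sub>a \<eta> (U $\<^sub>o Y)), coun = \<epsilon>\<rparr>"

locale lax_comonad_morphism =
  C: comonad A C + S: comonad B S +
  nat_trans B A "endo C \<circ>\<^sub>F U" "U \<circ>\<^sub>F endo S" \<Omega>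
  for A :: "('oa, 'ma) cat" and B :: "('ob, 'mb) cat"
    and U :: "('ob, 'mb, 'oa, 'ma) funct"
    and C :: "('oa, 'ma) comonad_data" and S :: "('ob, 'mb) comonad_data"
    and \<Omega> :: "'ob \<Rightarrow> 'ma" +
  assumes lax_coun: "Y \<in> Obj B \<Longrightarrow> (U $\<^sub>a coun S Y) \<cdot>\<^bsub>A\<^esub> \<Omega> Y = coun C (U $\<^sub>o Y)"
    and lax_comult: "Y \<in> Obj B \<Longrightarrow>
      (U $\<^sub>a comult S Y) \<cdot>\<^bsub>A\<^esub> \<Omega> Y =
      \<Omega> (endo S $\<^sub>o Y) \<cdot>\<^bsub>A\<^esub> (endo C $\<^sub>a \<Omega> Y) \<cdot>\<^bsub>A\<^esub> comult C (U $\<^sub>o Y)"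

locale comonad_lift =
  lax_comonad_morphism A B U C S \<Omega> +
  nat_iso B A "endo C \<circ>\<^sub>F U" "U \<circ>\<^sub>F endo S" \<Omega>
  for A :: "('oa, 'ma) cat" and B :: "('ob, 'mb) cat"
    and U :: "('ob, 'mb, 'oa, 'ma) funct"
    and C :: "('oa, 'ma) comonad_data" and S :: "('ob, 'mb) comonad_data"
    and \<Omega> :: "'ob \<Rightarrow> 'ma"

text \<open>\<open>lift_mate\<close> is the transformation \<open>\<Lambda> : FC \<rightarrow> SF\<close>, the transpose of \<open>\<Omega>F \<circ> C\<eta> : C \<rightarrow> USF\<close>.\<close>

definition lift_mate ::
  "('oa, 'ma) cat \<Rightarrow> ('ob, 'mb) cat \<Rightarrow>
    ('oa, 'ma, 'ob, 'mb) funct \<Rightarrow> ('oa \<Rightarrow> 'ma) \<Rightarrow> ('ob \<Rightarrow> 'mb) \<Rightarrow>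
    ('oa, 'ma) comonad_data \<Rightarrow> ('ob, 'mb) comonad_data \<Rightarrow> ('ob \<Rightarrow> 'ma) \<Rightarrow> 'oa \<Rightarrow> 'mb" where
  "lift_mate A B F \<eta> \<epsilon> C S \<Omega> =
     (\<lambda>X \<in> Obj A. to_left B F \<epsilon> (endo S $\<^sub>o F $\<^sub>o X) (\<Omega> (F $\<^sub>o X) \<cdot>\<^bsub>A\<^esub> (endo C $\<^sub>a \<eta> X)))"

definition distr_law ::
  "('oa, 'ma) cat \<Rightarrow> ('ob, 'mb) cat \<Rightarrow>
    ('oa, 'ma, 'ob, 'mb) funct \<Rightarrow> ('ob, 'mb, 'oa, 'ma) funct \<Rightarrow> ('oa \<Rightarrow> 'ma) \<Rightarrow> ('ob \<Rightarrow> 'mb) \<Rightarrow>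
    ('oa, 'ma) comonad_data \<Rightarrow> ('ob, 'mb) comonad_data \<Rightarrow> ('ob \<Rightarrow> 'ma) \<Rightarrow> 'ob \<Rightarrow> 'mb" where
  "distr_law A B F U \<eta> \<epsilon> C S \<Omega> =
     (\<lambda>Y \<in> Obj B. lift_mate A B F \<eta> \<epsilon> C S \<Omega> (U $\<^sub>o Y) \<cdot>\<^bsub>B\<^esub> (F $\<^sub>a inv_arr A (\<Omega> Y)))"

definition right_chi_coalgebra ::
  "('oy, 'my) cat \<Rightarrow> ('ob, 'mb) cat \<Rightarrow> ('ob, 'mb) comonad_data \<Rightarrow> ('ob, 'mb) comonad_data \<Rightarrow>
    ('ob \<Rightarrow> 'mb) \<Rightarrow> ('oy, 'my, 'ob, 'mb) funct \<Rightarrow> ('oy \<Rightarrow> 'mb) \<Rightarrow> bool" where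
  "right_chi_coalgebra Y B T S \<chi> M \<rho> \<longleftrightarrow>
     nat_trans Y B (endo T \<circ>\<^sub>F M) (endo S \<circ>\<^sub>F M) \<rho> \<and>
     (\<forall>y \<in> Obj Y. coun S (M $\<^sub>o y) \<cdot>\<^bsub>B\<^esub> \<rho> y = coun T (M $\<^sub>o y)) \<and>
     (\<forall>y \<in> Obj Y. comult S (M $\<^sub>o y) \<cdot>\<^bsub>B\<^esub> \<rho> y =
        (endo S $\<^sub>a \<rho> y) \<cdot>\<^bsub>B\<^esub> \<chi> (M $\<^sub>o y) \<cdot>\<^bsub>B\<^esub> (endo T $\<^sub>a \<rho> y) \<cdot>\<^bsub>B\<^esub> comult T (M $\<^sub>o y))"

definition coalgebra_structure ::
  "('oy, 'my) cat \<Rightarrow> ('oa, 'ma) cat \<Rightarrow> ('oa, 'ma) comonad_data \<Rightarrow>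
    ('oy, 'my, 'oa, 'ma) funct \<Rightarrow> ('oy \<Rightarrow> 'ma) \<Rightarrow> bool" where
  "coalgebra_structure Y A C P \<delta> \<longleftrightarrow>
     nat_trans Y A P (endo C \<circ>\<^sub>F P) \<delta> \<and>
     (\<forall>y \<in> Obj Y. comult C (P $\<^sub>o y) \<cdot>\<^bsub>A\<^esub> \<delta> y = (endo C $\<^sub>a \<delta> y) \<cdot>\<^bsub>A\<^esub> \<delta> y) \<and>
     (\<forall>y \<in> Obj Y. coun C (P $\<^sub>o y) \<cdot>\<^bsub>A\<^esub> \<delta> y = Ident A (P $\<^sub>o y))"

text \<open>
  The correspondence between \<open>\<rho> : FUM \<rightarrow> SM\<close> and \<open>\<delta> : UM \<rightarrow> CUM\<close>: transpose \<open>\<rho>\<close> to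
  \<open>UM \<rightarrow> USM\<close> and compose with \<open>\<Omega>\<^sup>-\<^sup>1M : USM \<rightarrow> CUM\<close>.
\<close>

definition coalgebra_of ::
  "('oy, 'my) cat \<Rightarrow> ('oa, 'ma) cat \<Rightarrow> ('ob, 'mb, 'oa, 'ma) funct \<Rightarrow> ('oa \<Rightarrow> 'ma) \<Rightarrow>
    ('ob \<Rightarrow> 'ma) \<Rightarrow> ('oy, 'my, 'ob, 'mb) funct \<Rightarrow> ('oy \<Rightarrow> 'mb) \<Rightarrow> 'oy \<Rightarrow> 'ma" where
  "coalgebra_of Y A U \<eta> \<Omega> M \<rho> =
     (\<lambda>y \<in> Obj Y. inv_arr A (\<Omega> (M $\<^sub>o y)) \<cdot>\<^bsub>A\<^esub> to_right A U \<eta> (U $\<^sub>o M $\<^sub>o y) (\<rho> y))"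

text \<open>\<open>galois_map \<dots> X Y\<close> is the component \<open>B(FX,SY) \<rightarrow> B(FX,VY)\<close> of the Galois map.\<close>

definition galois_map ::
  "('oa, 'ma) cat \<Rightarrow> ('ob, 'mb) cat \<Rightarrow>
    ('oa, 'ma, 'ob, 'mb) funct \<Rightarrow> ('ob, 'mb, 'oa, 'ma) funct \<Rightarrow> ('oa \<Rightarrow> 'ma) \<Rightarrow> ('ob \<Rightarrow> 'mb) \<Rightarrow>
    ('ob \<Rightarrow> 'ma) \<Rightarrow> ('ob, 'mb) comonad_data \<Rightarrow> ('ob \<Rightarrow> 'ma) \<Rightarrow> 'oa \<Rightarrow> 'ob \<Rightarrow> 'mb \<Rightarrow> 'mb" where
  "galois_map A B F U \<eta> \<epsilon> \<Omega> V \<Phi> X Y f =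
     to_left B F \<epsilon> (endo V $\<^sub>o Y) ((\<Phi> Y \<cdot>\<^bsub>A\<^esub> inv_arr A (\<Omega> Y)) \<cdot>\<^bsub>A\<^esub> to_right A U \<eta> X f)"

definition galois_on ::
  "('oy, 'my) cat \<Rightarrow> ('oa, 'ma) cat \<Rightarrow> ('ob, 'mb) cat \<Rightarrow>
    ('oa, 'ma, 'ob, 'mb) funct \<Rightarrow> ('ob, 'mb, 'oa, 'ma) funct \<Rightarrow> ('oa \<Rightarrow> 'ma) \<Rightarrow> ('ob \<Rightarrow> 'mb) \<Rightarrow>
    ('ob \<Rightarrow> 'ma) \<Rightarrow> ('ob, 'mb) comonad_data \<Rightarrow> ('ob \<Rightarrow> 'ma) \<Rightarrow>
    ('oy, 'my, 'ob, 'mb) funct \<Rightarrow> ('oy \<Rightarrow> 'mb) \<Rightarrow> 'oy \<Rightarrow> 'mb" where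
  "galois_on Y A B F U \<eta> \<epsilon> \<Omega> V \<Phi> M \<rho> =
     (\<lambda>y \<in> Obj Y. galois_map A B F U \<eta> \<epsilon> \<Omega> V \<Phi> (U $\<^sub>o M $\<^sub>o y) (M $\<^sub>o y) (\<rho> y))"

end

theory Submission
  imports Defs
begin

text \<open>
  Transposition along the adjunction followed by \<open>\<Omega>\<^sup>-\<^sup>1\<close> is a bijection
  \<open>B(FUm, Sm) = A(Um, CUm)\<close> for every object \<open>m\<close> of \<open>B\<close>. If \<open>\<rho>\<close> corresponds to \<open>\<delta>\<close>, then the
  transposes of the two sides of the comultiplication law for \<open>\<rho>\<close> are \<open>\<Omega>S \<circ> C\<Omega> \<circ> \<Delta>\<^sup>C \<circ> \<delta>\<close> and
  \<open>\<Omega>S \<circ> C\<Omega> \<circ> C\<delta> \<circ> \<delta>\<close>, so the law for \<open>\<rho>\<close> is equivalent to coassociativity of \<open>\<delta>\<close>; naturality and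
  the counit law are translated in the same way. The Galois map is the bijection for \<open>S\<close> followed by
  the inverse of the one for \<open>V\<close>.
\<close>

section \<open>Arrow calculus in categories, functors and natural transformations\<close>

lemma fcomp_obj [simp]: "(G \<circ>\<^sub>F F) $\<^sub>o X = G $\<^sub>o F $\<^sub>o X"
  and fcomp_arr [simp]: "(G \<circ>\<^sub>F F) $\<^sub>a f = G $\<^sub>a F $\<^sub>a f"
  by (simp_all add: fcomp_def)

lemma id_funct_obj [simp]: "id_funct $\<^sub>o X = X"
  and id_funct_arr [simp]: "id_funct $\<^sub>a f = f"
  by (simp_all add: id_funct_def)

context category
begin

lemma Dom_in_Obj [simp]: "f \<in> Arr A \<Longrightarrow> Dom A f \<in> Obj A"
  by (rule Dom_Obj)

lemma Cod_in_Obj [simp]: "f \<in> Arr A \<Longrightarrow> Cod A f \<in> Obj A"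
  by (rule Cod_Obj)

lemma Ident_arr [simp]:
  assumes "X \<in> Obj A"
  shows "Ident A X \<in> Arr A" "Dom A (Ident A X) = X" "Cod A (Ident A X) = X"
  using Ident_hom[OF assms] by (auto simp: hom_def)

text \<open>Membership in \<open>hom\<close> is recast as equations for \<open>Dom\<close> and
  \<open>Cod\<close>, so that the simplifier can discharge composability conditions without guessing
  the objects in between.\<close>

lemma Comp_arr [simp]:
  assumes "f \<in> Arr A" "g \<in> Arr A" "Cod A f = Dom A g"
  shows "g \<cdot> f \<in> Arr A" "Dom A (g \<cdot> f) = Dom A f" "Cod A (g \<cdot> f) = Cod A g"
  using Comp_hom[of f "Dom A f" "Cod A f" g "Cod A g"] assms by (auto simp: hom_def)

lemma Comp_arr_assoc:
  assumes "f \<in> Arr A" "g \<in> Arr A" "h \<in> Arr A" "Cod A f = Dom A g" "Cod A g = Dom A h"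
  shows "(h \<cdot> g) \<cdot> f = h \<cdot> (g \<cdot> f)"
  using Comp_assoc[of f "Dom A f" "Cod A f" g "Cod A g" h "Cod A h"] assms by (auto simp: hom_def)

lemma Comp_arr_Ident [simp]:
  assumes "f \<in> Arr A"
  shows "Y = Cod A f \<Longrightarrow> Ident A Y \<cdot> f = f" "X = Dom A f \<Longrightarrow> f \<cdot> Ident A X = f"
  using assms Comp_Ident_left Comp_Ident_right by (auto simp: hom_def)

text \<open>A two-sided inverse is unique, since \<open>g' = g' (f g) = (g' f) g = g\<close>; hence
  the \<open>THE\<close> in \<open>inv_arr\<close> picks an actual inverse.\<close>

lemma inverse_arrows_inv_arr:
  assumes "iso A f"
  shows "inverse_arrows A f (inv_arr A f)"
proof -
  obtain g where g: "inverse_arrows A f g"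
    using assms by (auto simp: iso_def)
  have "g' = g" if g': "inverse_arrows A f g'" for g'
  proof -
    have "g' = g' \<cdot> (f \<cdot> g)"
      using g g' by (auto simp: inverse_arrows_def hom_def)
    also have "\<dots> = (g' \<cdot> f) \<cdot> g"
      using g g' by (intro Comp_arr_assoc[symmetric]) (auto simp: inverse_arrows_def hom_def)
    also have "\<dots> = g"
      using g g' by (auto simp: inverse_arrows_def hom_def)
    finally show ?thesis .
  qed
  with g show ?thesis
    unfolding inv_arr_def by (rule theI)
qed

lemma iso_arr: "iso A f \<Longrightarrow> f \<in> Arr A"
  by (auto simp: iso_def inverse_arrows_def)

lemma inv_arr_arr [simp]:
  assumes "iso A f"
  shows "inv_arr A f \<in> Arr A" "Dom A (inv_arr A f) = Cod A f" "Cod A (inv_arr A f) = Dom A f"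
  using inverse_arrows_inv_arr[OF assms] by (auto simp: inverse_arrows_def hom_def)

lemma inv_arr_Comp [simp]:
  assumes "iso A f"
  shows "inv_arr A f \<cdot> f = Ident A (Dom A f)" "f \<cdot> inv_arr A f = Ident A (Cod A f)"
  using inverse_arrows_inv_arr[OF assms] by (auto simp: inverse_arrows_def)

text \<open>Composites are normalised with brackets to the right, where \<open>f\<close> and
  \<open>inv_arr A f\<close> meet in front of a remaining factor \<open>g\<close>; these rules
  cancel them there.\<close>

lemma inv_arr_Comp_assoc [simp]:
  assumes "iso A f" "g \<in> Arr A"
  shows "Cod A g = Dom A f \<Longrightarrow> inv_arr A f \<cdot> (f \<cdot> g) = g"
    and "Cod A g = Cod A f \<Longrightarrow> f \<cdot> (inv_arr A f \<cdot> g) = g"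
  using assms iso_arr[OF assms(1)] by (simp_all flip: Comp_arr_assoc)

lemma iso_Comp_cancel:
  assumes "iso A h" "f \<in> Arr A" "g \<in> Arr A" "Cod A f = Dom A h" "Cod A g = Dom A h"
  shows "h \<cdot> f = h \<cdot> g \<longleftrightarrow> f = g"
  using assms inv_arr_Comp_assoc(1) by metis

end

context cat_functor
begin

lemma Obj_in_Obj [simp]: "X \<in> Obj A \<Longrightarrow> F $\<^sub>o X \<in> Obj B"
  by (rule Obj)

lemma map_arr [simp]:
  assumes "f \<in> Arr A"
  shows "F $\<^sub>a f \<in> Arr B" "Dom B (F $\<^sub>a f) = F $\<^sub>o Dom A f" "Cod B (F $\<^sub>a f) = F $\<^sub>o Cod A f"
  using hom[of f "Dom A f" "Cod A f"] assms by (auto simp: hom_def)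

lemma map_Ident [simp]: "X \<in> Obj A \<Longrightarrow> F $\<^sub>a Ident A X = Ident B (F $\<^sub>o X)"
  by (rule Ident)

lemma map_Comp:
  assumes "f \<in> Arr A" "g \<in> Arr A" "Cod A f = Dom A g"
  shows "F $\<^sub>a (g \<cdot>\<^bsub>A\<^esub> f) = (F $\<^sub>a g) \<cdot>\<^bsub>B\<^esub> (F $\<^sub>a f)"
  using Comp[of f "Dom A f" "Cod A f" g "Cod A g"] assms by (auto simp: hom_def)

text \<open>Functoriality carries the inverse equations over. This makes
  \<open>endo C $\<^sub>a \<Omega> m\<close> cancellable later.\<close>

lemma map_iso:
  assumes "iso A f"
  shows "iso B (F $\<^sub>a f)"
  unfolding iso_def
proof
  show "inverse_arrows B (F $\<^sub>a f) (F $\<^sub>a inv_arr A f)"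
    using assms A.iso_arr[OF assms] by (simp add: inverse_arrows_def hom_def flip: map_Comp)
qed

end

lemma cat_functor_fcomp:
  assumes "cat_functor A B F" "cat_functor B C G"
  shows "cat_functor A C (G \<circ>\<^sub>F F)"
proof -
  interpret F: cat_functor A B F by fact
  interpret G: cat_functor B C G by fact
  show ?thesis
    by unfold_locales (auto intro: F.hom G.hom F.Comp simp: F.Comp G.Comp[OF F.hom F.hom])
qed

context nat_trans
begin

lemma component_arr [simp]:
  assumes "X \<in> Obj A"
  shows "\<tau> X \<in> Arr B" "Dom B (\<tau> X) = F $\<^sub>o X" "Cod B (\<tau> X) = G $\<^sub>o X"
  using PiE_mem[OF components assms] by (auto simp: hom_def)

lemma naturality_arr:
  assumes "f \<in> Arr A"
  shows "(G $\<^sub>a f) \<cdot>\<^bsub>B\<^esub> \<tau> (Dom A f) = \<tau> (Cod A f) \<cdot>\<^bsub>B\<^esub> (F $\<^sub>a f)"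
  using naturality[of f] assms by (auto simp: hom_def)

end

section \<open>Transposition along the adjunction\<close>

context adjunction
begin

lemma to_right_arr [simp]:
  assumes "f \<in> Arr B" "Dom B f = F $\<^sub>o X" "X \<in> Obj A"
  shows "to_right A U \<eta> X f \<in> Arr A" "Dom A (to_right A U \<eta> X f) = X"
    "Cod A (to_right A U \<eta> X f) = U $\<^sub>o Cod B f"
  using assms by (simp_all add: to_right_def)

lemma to_left_arr [simp]:
  assumes "g \<in> Arr A" "Cod A g = U $\<^sub>o Z" "Z \<in> Obj B"
  shows "to_left B F \<epsilon> Z g \<in> Arr B" "Dom B (to_left B F \<epsilon> Z g) = F $\<^sub>o Dom A g"
    "Cod B (to_left B F \<epsilon> Z g) = Z"
  using assms by (simp_all add: to_left_def)

text \<open>Naturality of the transposition in the target, which is functoriality of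
  \<open>U\<close>.\<close>

lemma to_right_Comp:
  assumes "f \<in> Arr B" "g \<in> Arr B" "Cod B f = Dom B g" "Dom B f = F $\<^sub>o X" "X \<in> Obj A"
  shows "to_right A U \<eta> X (g \<cdot>\<^bsub>B\<^esub> f) = (U $\<^sub>a g) \<cdot>\<^bsub>A\<^esub> to_right A U \<eta> X f"
  using assms by (simp add: to_right_def U.map_Comp F.A.Comp_arr_assoc)

text \<open>Naturality of the transposition in the source, which comes from naturality of the unit
  at \<open>g\<close>.\<close>

lemma to_right_Comp_map:
  assumes "f \<in> Arr B" "g \<in> Arr A" "Dom B f = F $\<^sub>o Cod A g" "Dom A g = X"
  shows "to_right A U \<eta> X (f \<cdot>\<^bsub>B\<^esub> (F $\<^sub>a g)) = to_right A U \<eta> (Cod A g) f \<cdot>\<^bsub>A\<^esub> g"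
  using assms unit.naturality_arr[of g] by (auto simp: to_right_def U.map_Comp F.A.Comp_arr_assoc)

lemma to_right_counit [simp]:
  "Z \<in> Obj B \<Longrightarrow> to_right A U \<eta> (U $\<^sub>o Z) (\<epsilon> Z) = Ident A (U $\<^sub>o Z)"
  by (simp add: to_right_def triangle_right)

text \<open>Naturality in the source splits off \<open>g\<close>; what remains is the transpose of
  the counit, an identity by the right triangle law.\<close>

lemma to_right_to_left [simp]:
  assumes "g \<in> Arr A" "Cod A g = U $\<^sub>o Z" "Z \<in> Obj B" "Dom A g = X"
  shows "to_right A U \<eta> X (to_left B F \<epsilon> Z g) = g"
  using assms by (simp add: to_left_def to_right_Comp_map)

text \<open>Naturality of the counit moves \<open>f\<close> to the front; the left triangle law then
  removes \<open>\<epsilon> (F $\<^sub>o X)\<close> together with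
  \<open>F $\<^sub>a \<eta> X\<close>.\<close>

lemma to_left_to_right [simp]:
  assumes "f \<in> Arr B" "Dom B f = F $\<^sub>o X" "Cod B f = Z" "X \<in> Obj A"
  shows "to_left B F \<epsilon> Z (to_right A U \<eta> X f) = f"
proof -
  have "\<epsilon> Z \<cdot>\<^bsub>B\<^esub> ((F $\<^sub>a U $\<^sub>a f) \<cdot>\<^bsub>B\<^esub> (F $\<^sub>a \<eta> X)) = (\<epsilon> Z \<cdot>\<^bsub>B\<^esub> (F $\<^sub>a U $\<^sub>a f)) \<cdot>\<^bsub>B\<^esub> (F $\<^sub>a \<eta> X)"
    using assms by (auto simp: F.B.Comp_arr_assoc)
  also have "\<dots> = (f \<cdot>\<^bsub>B\<^esub> \<epsilon> (F $\<^sub>o X)) \<cdot>\<^bsub>B\<^esub> (F $\<^sub>a \<eta> X)"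
    using assms counit.naturality_arr[of f] by simp
  also have "\<dots> = f"
    using assms by (simp add: F.B.Comp_arr_assoc triangle_left)
  finally show ?thesis
    using assms by (simp add: to_left_def to_right_def F.map_Comp)
qed

text \<open>Allows equations between arrows of \<open>B\<close> out of \<open>F $\<^sub>o X\<close>
  to be tested after transposing to \<open>A\<close>, where the components of
  \<open>\<Omega>\<close> live.\<close>

lemma to_right_inject:
  assumes "f \<in> Arr B" "g \<in> Arr B" "Dom B f = F $\<^sub>o X" "Dom B g = F $\<^sub>o X" "Cod B f = Cod B g"
    and "X \<in> Obj A"
  shows "to_right A U \<eta> X f = to_right A U \<eta> X g \<longleftrightarrow> f = g"
  using assms to_left_to_right by metis

end

section \<open>Lifts through the adjunction and their distributive laws\<close>

locale lifted_adjunction =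
  adjunction A B F U \<eta> \<epsilon> + lift: comonad_lift A B U C S \<Omega>
  for A :: "('oa, 'ma) cat" and B :: "('ob, 'mb) cat"
    and F :: "('oa, 'ma, 'ob, 'mb) funct" and U :: "('ob, 'mb, 'oa, 'ma) funct"
    and \<eta> :: "'oa \<Rightarrow> 'ma" and \<epsilon> :: "'ob \<Rightarrow> 'mb"
    and C :: "('oa, 'ma) comonad_data" and S :: "('ob, 'mb) comonad_data"
    and \<Omega> :: "'ob \<Rightarrow> 'ma"
begin

declare lift.iso [simp]

lemma to_right_lift_mate:
  assumes "X \<in> Obj A"
  shows "to_right A U \<eta> (endo C $\<^sub>o X) (lift_mate A B F \<eta> \<epsilon> C S \<Omega> X) =
    \<Omega> (F $\<^sub>o X) \<cdot>\<^bsub>A\<^esub> (endo C $\<^sub>a \<eta> X)"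
  using assms by (simp add: lift_mate_def)

lemma lift_mate_arr [simp]:
  assumes "X \<in> Obj A"
  shows "lift_mate A B F \<eta> \<epsilon> C S \<Omega> X \<in> Arr B"
    "Dom B (lift_mate A B F \<eta> \<epsilon> C S \<Omega> X) = F $\<^sub>o endo C $\<^sub>o X"
    "Cod B (lift_mate A B F \<eta> \<epsilon> C S \<Omega> X) = endo S $\<^sub>o F $\<^sub>o X"
  using assms by (simp_all add: lift_mate_def)

section \<open>The two coalgebra laws at one object, for a corresponding pair \<open>r\<close>,
  \<open>d\<close>\<close>

context
  fixes m r d
  assumes m: "m \<in> Obj B"
    and r: "r \<in> Arr B" "Dom B r = F $\<^sub>o U $\<^sub>o m" "Cod B r = endo S $\<^sub>o m"
    and d: "d \<in> Arr A" "Dom A d = U $\<^sub>o m" "Cod A d = endo C $\<^sub>o U $\<^sub>o m"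
    and transpose: "to_right A U \<eta> (U $\<^sub>o m) r = \<Omega> m \<cdot>\<^bsub>A\<^esub> d"
begin

text \<open>The counit transposes to the identity, and on the other side \<open>lax_coun\<close>
  absorbs \<open>\<Omega> m\<close>; injectivity of the transposition does the rest.\<close>

lemma counit_law_iff:
  "coun S m \<cdot>\<^bsub>B\<^esub> r = \<epsilon> m \<longleftrightarrow> coun C (U $\<^sub>o m) \<cdot>\<^bsub>A\<^esub> d = Ident A (U $\<^sub>o m)"
proof -
  have "to_right A U \<eta> (U $\<^sub>o m) (coun S m \<cdot>\<^bsub>B\<^esub> r) = (U $\<^sub>a coun S m) \<cdot>\<^bsub>A\<^esub> (\<Omega> m \<cdot>\<^bsub>A\<^esub> d)"
    using m r transpose by (simp add: to_right_Comp)
  also have "\<dots> = ((U $\<^sub>a coun S m) \<cdot>\<^bsub>A\<^esub> \<Omega> m) \<cdot>\<^bsub>A\<^esub> d"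
    using m d by (simp add: F.A.Comp_arr_assoc)
  also have "\<dots> = coun C (U $\<^sub>o m) \<cdot>\<^bsub>A\<^esub> d"
    using m by (simp add: lift.lax_coun)
  finally show ?thesis
    using m r to_right_inject[of "coun S m \<cdot>\<^bsub>B\<^esub> r" "\<epsilon> m" "U $\<^sub>o m"] by simp
qed

text \<open>The factor \<open>\<Omega> m\<close> in the transpose of \<open>r\<close> is what
  \<open>lax_comult\<close> requires. The result is bracketed to the right so that
  \<open>\<Omega> (endo S $\<^sub>o m)\<close> and \<open>endo C $\<^sub>a \<Omega> m\<close> stand
  in front, ready for cancellation.\<close>

lemma to_right_comult:
  "to_right A U \<eta> (U $\<^sub>o m) (comult S m \<cdot>\<^bsub>B\<^esub> r) =
    \<Omega> (endo S $\<^sub>o m) \<cdot>\<^bsub>A\<^esub> ((endo C $\<^sub>a \<Omega> m) \<cdot>\<^bsub>A\<^esub> (comult C (U $\<^sub>o m) \<cdot>\<^bsub>A\<^esub> d))"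
proof -
  have "to_right A U \<eta> (U $\<^sub>o m) (comult S m \<cdot>\<^bsub>B\<^esub> r) = ((U $\<^sub>a comult S m) \<cdot>\<^bsub>A\<^esub> \<Omega> m) \<cdot>\<^bsub>A\<^esub> d"
    using m r d transpose by (simp add: to_right_Comp F.A.Comp_arr_assoc)
  also have "\<dots> = (\<Omega> (endo S $\<^sub>o m) \<cdot>\<^bsub>A\<^esub> (endo C $\<^sub>a \<Omega> m) \<cdot>\<^bsub>A\<^esub> comult C (U $\<^sub>o m)) \<cdot>\<^bsub>A\<^esub> d"
    using m by (simp only: lift.lax_comult)
  finally show ?thesis
    using m d by (simp add: F.A.Comp_arr_assoc)
qed

text \<open>By functoriality the two rightmost factors form \<open>F\<close> of the transpose of
  \<open>r\<close>, that is, of \<open>\<Omega> m\<close> after \<open>d\<close>. The inverse of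
  \<open>\<Omega> m\<close> inside the distributive law cancels there and leaves
  \<open>F $\<^sub>a d\<close>.\<close>

lemma distr_law_Comp:
  "(endo S $\<^sub>a r) \<cdot>\<^bsub>B\<^esub> distr_law A B F U \<eta> \<epsilon> C S \<Omega> m \<cdot>\<^bsub>B\<^esub> (F $\<^sub>a U $\<^sub>a r) \<cdot>\<^bsub>B\<^esub> (F $\<^sub>a \<eta> (U $\<^sub>o m)) =
    (endo S $\<^sub>a r) \<cdot>\<^bsub>B\<^esub> (lift_mate A B F \<eta> \<epsilon> C S \<Omega> (U $\<^sub>o m) \<cdot>\<^bsub>B\<^esub> (F $\<^sub>a d))"
proof -
  have "(F $\<^sub>a inv_arr A (\<Omega> m)) \<cdot>\<^bsub>B\<^esub> ((F $\<^sub>a U $\<^sub>a r) \<cdot>\<^bsub>B\<^esub> (F $\<^sub>a \<eta> (U $\<^sub>o m)))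
      = F $\<^sub>a (inv_arr A (\<Omega> m) \<cdot>\<^bsub>A\<^esub> to_right A U \<eta> (U $\<^sub>o m) r)"
    using m r by (simp add: to_right_def F.map_Comp)
  also have "\<dots> = F $\<^sub>a d"
    using m d transpose by simp
  finally show ?thesis
    using m r by (simp add: distr_law_def F.B.Comp_arr_assoc)
qed

text \<open>Only the mate survives from the distributive law, and its transpose is known. Naturality
  of \<open>\<Omega>\<close> lets \<open>r\<close> pass under \<open>C\<close>, where it joins the
  unit to form \<open>C\<close> of the transpose of \<open>r\<close>; this yields the second copy of
  \<open>d\<close>.\<close>

lemma to_right_distr_law:
  "to_right A U \<eta> (U $\<^sub>o m)
     ((endo S $\<^sub>a r) \<cdot>\<^bsub>B\<^esub> distr_law A B F U \<eta> \<epsilon> C S \<Omega> m \<cdot>\<^bsub>B\<^esub> (F $\<^sub>a U $\<^sub>a r) \<cdot>\<^bsub>B\<^esub> (F $\<^sub>a \<eta> (U $\<^sub>o m))) =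
    \<Omega> (endo S $\<^sub>o m) \<cdot>\<^bsub>A\<^esub> ((endo C $\<^sub>a \<Omega> m) \<cdot>\<^bsub>A\<^esub> ((endo C $\<^sub>a d) \<cdot>\<^bsub>A\<^esub> d))" (is "?lhs = _")
proof -
  have mate: "to_right A U \<eta> (U $\<^sub>o m) (lift_mate A B F \<eta> \<epsilon> C S \<Omega> (U $\<^sub>o m) \<cdot>\<^bsub>B\<^esub> (F $\<^sub>a d)) =
      \<Omega> (F $\<^sub>o U $\<^sub>o m) \<cdot>\<^bsub>A\<^esub> ((endo C $\<^sub>a \<eta> (U $\<^sub>o m)) \<cdot>\<^bsub>A\<^esub> d)"
    using m d by (simp add: to_right_Comp_map to_right_lift_mate F.A.Comp_arr_assoc)
  have "?lhs = ((U $\<^sub>a endo S $\<^sub>a r) \<cdot>\<^bsub>A\<^esub> \<Omega> (F $\<^sub>o U $\<^sub>o m)) \<cdot>\<^bsub>A\<^esub> ((endo C $\<^sub>a \<eta> (U $\<^sub>o m)) \<cdot>\<^bsub>A\<^esub> d)"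
    using m r d unfolding distr_law_Comp
    by (subst to_right_Comp) (simp_all add: mate F.A.Comp_arr_assoc)
  \<comment> \<open>Naturality of \<open>\<Omega>\<close> at \<open>r\<close>, seen as an arrow from
    \<open>F $\<^sub>o U $\<^sub>o m\<close> to \<open>endo S $\<^sub>o m\<close>.\<close>
  also have "\<dots> = (\<Omega> (endo S $\<^sub>o m) \<cdot>\<^bsub>A\<^esub> (endo C $\<^sub>a U $\<^sub>a r)) \<cdot>\<^bsub>A\<^esub> ((endo C $\<^sub>a \<eta> (U $\<^sub>o m)) \<cdot>\<^bsub>A\<^esub> d)"
    using lift.naturality_arr[OF r(1)] r by simp
  also have "\<dots> = \<Omega> (endo S $\<^sub>o m) \<cdot>\<^bsub>A\<^esub> ((endo C $\<^sub>a to_right A U \<eta> (U $\<^sub>o m) r) \<cdot>\<^bsub>A\<^esub> d)"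
    using m r d by (simp add: to_right_def lift.C.endo.map_Comp F.A.Comp_arr_assoc)
  also have "\<dots> = \<Omega> (endo S $\<^sub>o m) \<cdot>\<^bsub>A\<^esub> ((endo C $\<^sub>a \<Omega> m) \<cdot>\<^bsub>A\<^esub> ((endo C $\<^sub>a d) \<cdot>\<^bsub>A\<^esub> d))"
    using m d unfolding transpose by (simp add: lift.C.endo.map_Comp F.A.Comp_arr_assoc)
  finally show ?thesis .
qed

text \<open>Both transposes begin with the same two isomorphisms,
  \<open>\<Omega> (endo S $\<^sub>o m)\<close> and \<open>endo C $\<^sub>a \<Omega> m\<close>;
  cancelling them leaves coassociativity of \<open>d\<close>.\<close>

lemma comult_law_iff:
  "comult S m \<cdot>\<^bsub>B\<^esub> r =
     (endo S $\<^sub>a r) \<cdot>\<^bsub>B\<^esub> distr_law A B F U \<eta> \<epsilon> C S \<Omega> m \<cdot>\<^bsub>B\<^esub> (F $\<^sub>a U $\<^sub>a r) \<cdot>\<^bsub>B\<^esub> (F $\<^sub>a \<eta> (U $\<^sub>o m)) \<longleftrightarrow>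
   comult C (U $\<^sub>o m) \<cdot>\<^bsub>A\<^esub> d = (endo C $\<^sub>a d) \<cdot>\<^bsub>A\<^esub> d" (is "?l = ?r \<longleftrightarrow> _")
proof -
  have "?l = ?r \<longleftrightarrow> to_right A U \<eta> (U $\<^sub>o m) ?l = to_right A U \<eta> (U $\<^sub>o m) ?r"
    using m r d by (subst to_right_inject) (simp_all add: distr_law_Comp)
  also have "\<dots> \<longleftrightarrow> comult C (U $\<^sub>o m) \<cdot>\<^bsub>A\<^esub> d = (endo C $\<^sub>a d) \<cdot>\<^bsub>A\<^esub> d"
    unfolding to_right_comult to_right_distr_law
    using m d by (simp add: F.A.iso_Comp_cancel lift.C.endo.map_iso)
  finally show ?thesis .
qed

end

text \<open>Transposing both sides and moving \<open>\<Omega>\<close> past \<open>h\<close> by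
  naturality puts \<open>\<Omega> m'\<close> in front of each, where it cancels. The lemma is
  applied with \<open>h\<close> the image under \<open>M\<close> of an arrow of
  \<open>Y\<close>.\<close>

lemma naturality_iff:
  assumes m: "m \<in> Obj B"
    and r: "r \<in> Arr B" "Dom B r = F $\<^sub>o U $\<^sub>o m" "Cod B r = endo S $\<^sub>o m"
    and d: "d \<in> Arr A" "Dom A d = U $\<^sub>o m" "Cod A d = endo C $\<^sub>o U $\<^sub>o m"
    and transpose: "to_right A U \<eta> (U $\<^sub>o m) r = \<Omega> m \<cdot>\<^bsub>A\<^esub> d"
    and m': "m' \<in> Obj B"
    and r': "r' \<in> Arr B" "Dom B r' = F $\<^sub>o U $\<^sub>o m'" "Cod B r' = endo S $\<^sub>o m'"
    and d': "d' \<in> Arr A" "Dom A d' = U $\<^sub>o m'" "Cod A d' = endo C $\<^sub>o U $\<^sub>o m'"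
    and transpose': "to_right A U \<eta> (U $\<^sub>o m') r' = \<Omega> m' \<cdot>\<^bsub>A\<^esub> d'"
    and h: "h \<in> Arr B" "Dom B h = m" "Cod B h = m'"
  shows "(endo S $\<^sub>a h) \<cdot>\<^bsub>B\<^esub> r = r' \<cdot>\<^bsub>B\<^esub> (F $\<^sub>a U $\<^sub>a h) \<longleftrightarrow>
    (endo C $\<^sub>a U $\<^sub>a h) \<cdot>\<^bsub>A\<^esub> d = d' \<cdot>\<^bsub>A\<^esub> (U $\<^sub>a h)" (is "?l = ?r \<longleftrightarrow> _")
proof -
  have "to_right A U \<eta> (U $\<^sub>o m) ?l = ((U $\<^sub>a endo S $\<^sub>a h) \<cdot>\<^bsub>A\<^esub> \<Omega> m) \<cdot>\<^bsub>A\<^esub> d"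
    using m r d h transpose by (simp add: to_right_Comp F.A.Comp_arr_assoc)
  also have "\<dots> = (\<Omega> m' \<cdot>\<^bsub>A\<^esub> (endo C $\<^sub>a U $\<^sub>a h)) \<cdot>\<^bsub>A\<^esub> d"
    using lift.naturality_arr[OF h(1)] h by simp
  also have "\<dots> = \<Omega> m' \<cdot>\<^bsub>A\<^esub> ((endo C $\<^sub>a U $\<^sub>a h) \<cdot>\<^bsub>A\<^esub> d)"
    using m m' d h by (simp add: F.A.Comp_arr_assoc)
  finally have l: "to_right A U \<eta> (U $\<^sub>o m) ?l = \<dots>" .
  have r'': "to_right A U \<eta> (U $\<^sub>o m) ?r = \<Omega> m' \<cdot>\<^bsub>A\<^esub> (d' \<cdot>\<^bsub>A\<^esub> (U $\<^sub>a h))"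
    using m m' r' d' h transpose' by (simp add: to_right_Comp_map F.A.Comp_arr_assoc)
  have "?l = ?r \<longleftrightarrow> to_right A U \<eta> (U $\<^sub>o m) ?l = to_right A U \<eta> (U $\<^sub>o m) ?r"
    using m m' r r' h by (subst to_right_inject) simp_all
  also have "\<dots> \<longleftrightarrow> (endo C $\<^sub>a U $\<^sub>a h) \<cdot>\<^bsub>A\<^esub> d = d' \<cdot>\<^bsub>A\<^esub> (U $\<^sub>a h)"
    unfolding l r'' using m m' d d' h by (simp add: F.A.iso_Comp_cancel)
  finally show ?thesis .
qed

end

section \<open>From single components to structures on \<open>M\<close>\<close>

text \<open>The inverse of \<open>coalgebra_of\<close>. The lift is an explicit argument, so that
  the version for a second lift can be named beside the first.\<close>

definition chi_coalgebra_of ::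
  "('oy, 'my) cat \<Rightarrow> ('ob, 'mb) cat \<Rightarrow> ('oa, 'ma, 'ob, 'mb) funct \<Rightarrow> ('ob \<Rightarrow> 'mb) \<Rightarrow>
    ('ob, 'mb) comonad_data \<Rightarrow> ('ob \<Rightarrow> 'ma) \<Rightarrow> ('oa, 'ma) cat \<Rightarrow>
    ('oy, 'my, 'ob, 'mb) funct \<Rightarrow> ('oy \<Rightarrow> 'ma) \<Rightarrow> 'oy \<Rightarrow> 'mb" where
  "chi_coalgebra_of Y B F \<epsilon> S \<Omega> A M \<delta> =
     (\<lambda>y \<in> Obj Y. to_left B F \<epsilon> (endo S $\<^sub>o M $\<^sub>o y) (\<Omega> (M $\<^sub>o y) \<cdot>\<^bsub>A\<^esub> \<delta> y))"

locale lifted_adjunction_module =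
  lifted_adjunction A B F U \<eta> \<epsilon> C S \<Omega> + M: cat_functor Y B M
  for A :: "('oa, 'ma) cat" and B :: "('ob, 'mb) cat"
    and F :: "('oa, 'ma, 'ob, 'mb) funct" and U :: "('ob, 'mb, 'oa, 'ma) funct"
    and \<eta> :: "'oa \<Rightarrow> 'ma" and \<epsilon> :: "'ob \<Rightarrow> 'mb"
    and C :: "('oa, 'ma) comonad_data" and S :: "('ob, 'mb) comonad_data"
    and \<Omega> :: "'ob \<Rightarrow> 'ma"
    and Y :: "('oy, 'my) cat" and M :: "('oy, 'my, 'ob, 'mb) funct"
begin

text \<open>Families with the right sources and targets, not yet natural or subject to any law. On
  such families the two passages are already mutually inverse.\<close>

abbreviation chi_components where
  "chi_components \<equiv> \<Pi>\<^sub>E y \<in> Obj Y. hom B (F $\<^sub>o U $\<^sub>o M $\<^sub>o y) (endo S $\<^sub>o M $\<^sub>o y)"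

abbreviation coalgebra_components where
  "coalgebra_components \<equiv> \<Pi>\<^sub>E y \<in> Obj Y. hom A (U $\<^sub>o M $\<^sub>o y) (endo C $\<^sub>o U $\<^sub>o M $\<^sub>o y)"

abbreviation chi_coalgebras where
  "chi_coalgebras \<equiv> {\<rho>. right_chi_coalgebra Y B (induced_comonad B F U \<eta> \<epsilon>) S
     (distr_law A B F U \<eta> \<epsilon> C S \<Omega>) M \<rho>}"

abbreviation coalgebra_structures where
  "coalgebra_structures \<equiv> {\<delta>. coalgebra_structure Y A C (U \<circ>\<^sub>F M) \<delta>}"

lemma coalgebra_of_components:
  "\<rho> \<in> chi_components \<Longrightarrow> coalgebra_of Y A U \<eta> \<Omega> M \<rho> \<in> coalgebra_components"
  by (fastforce simp: coalgebra_of_def hom_def dest: PiE_mem)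

lemma chi_coalgebra_of_components:
  "\<delta> \<in> coalgebra_components \<Longrightarrow> chi_coalgebra_of Y B F \<epsilon> S \<Omega> A M \<delta> \<in> chi_components"
  by (fastforce simp: chi_coalgebra_of_def hom_def dest: PiE_mem)

lemma chi_coalgebra_of_coalgebra_of:
  assumes "\<rho> \<in> chi_components"
  shows "chi_coalgebra_of Y B F \<epsilon> S \<Omega> A M (coalgebra_of Y A U \<eta> \<Omega> M \<rho>) = \<rho>"
proof
  fix y
  show "chi_coalgebra_of Y B F \<epsilon> S \<Omega> A M (coalgebra_of Y A U \<eta> \<Omega> M \<rho>) y = \<rho> y"
    \<comment> \<open>Outside \<open>Obj Y\<close> both sides are \<open>undefined\<close>, the
      right one by \<open>PiE_arb\<close>.\<close>
    using PiE_mem[OF assms, of y] PiE_arb[OF assms, of y]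
    by (cases "y \<in> Obj Y") (auto simp: chi_coalgebra_of_def coalgebra_of_def hom_def)
qed

lemma coalgebra_of_chi_coalgebra_of:
  assumes "\<delta> \<in> coalgebra_components"
  shows "coalgebra_of Y A U \<eta> \<Omega> M (chi_coalgebra_of Y B F \<epsilon> S \<Omega> A M \<delta>) = \<delta>"
proof
  fix y
  show "coalgebra_of Y A U \<eta> \<Omega> M (chi_coalgebra_of Y B F \<epsilon> S \<Omega> A M \<delta>) y = \<delta> y"
    using PiE_mem[OF assms, of y] PiE_arb[OF assms, of y]
    by (cases "y \<in> Obj Y") (auto simp: chi_coalgebra_of_def coalgebra_of_def hom_def)
qed

lemma chi_coalgebras_components: "chi_coalgebras \<subseteq> chi_components"
  by (auto simp: right_chi_coalgebra_def induced_comonad_def dest!: nat_trans.components)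

lemma coalgebra_structures_components: "coalgebra_structures \<subseteq> coalgebra_components"
  by (auto simp: coalgebra_structure_def dest!: nat_trans.components)

text \<open>Composites of functors are functors, and \<open>chi_components\<close> fixes the typing,
  so only the naturality squares remain.\<close>

lemma nat_trans_chi_iff:
  assumes "\<rho> \<in> chi_components"
  shows "nat_trans Y B ((F \<circ>\<^sub>F U) \<circ>\<^sub>F M) (endo S \<circ>\<^sub>F M) \<rho> \<longleftrightarrow>
    (\<forall>f \<in> Arr Y. (endo S $\<^sub>a M $\<^sub>a f) \<cdot>\<^bsub>B\<^esub> \<rho> (Dom Y f) = \<rho> (Cod Y f) \<cdot>\<^bsub>B\<^esub> (F $\<^sub>a U $\<^sub>a M $\<^sub>a f))"
  (is "?n \<longleftrightarrow> ?s")
proof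
  assume ?n
  then show ?s by (force dest: nat_trans.naturality_arr)
next
  assume ?s
  have "cat_functor Y B ((F \<circ>\<^sub>F U) \<circ>\<^sub>F M)" "cat_functor Y B (endo S \<circ>\<^sub>F M)"
    by (intro cat_functor_fcomp[of _ B] cat_functor_fcomp[of B A] M.cat_functor_axioms
      F.cat_functor_axioms U.cat_functor_axioms lift.S.endo.cat_functor_axioms)+
  then show ?n
    using \<open>?s\<close> assms by (auto simp: nat_trans_def nat_trans_axioms_def hom_def)
qed

lemma nat_trans_coalgebra_iff:
  assumes "\<delta> \<in> coalgebra_components"
  shows "nat_trans Y A (U \<circ>\<^sub>F M) (endo C \<circ>\<^sub>F U \<circ>\<^sub>F M) \<delta> \<longleftrightarrow>
    (\<forall>f \<in> Arr Y. (endo C $\<^sub>a U $\<^sub>a M $\<^sub>a f) \<cdot>\<^bsub>A\<^esub> \<delta> (Dom Y f) = \<delta> (Cod Y f) \<cdot>\<^bsub>A\<^esub> (U $\<^sub>a M $\<^sub>a f))"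
  (is "?n \<longleftrightarrow> ?s")
proof
  assume ?n
  then show ?s by (force dest: nat_trans.naturality_arr)
next
  assume ?s
  have "cat_functor Y A (U \<circ>\<^sub>F M)" "cat_functor Y A (endo C \<circ>\<^sub>F U \<circ>\<^sub>F M)"
    by (intro cat_functor_fcomp[of _ A] cat_functor_fcomp[of _ B] M.cat_functor_axioms
      U.cat_functor_axioms lift.C.endo.cat_functor_axioms)+
  then show ?n
    using \<open>?s\<close> assms by (auto simp: nat_trans_def nat_trans_axioms_def hom_def)
qed

text \<open>Each condition translates by an equivalence at single objects or arrows of
  \<open>Y\<close>, so one lemma serves both directions of the correspondence.\<close>

lemma coalgebra_structure_coalgebra_of_iff:
  assumes \<rho>: "\<rho> \<in> chi_components"
  shows "coalgebra_of Y A U \<eta> \<Omega> M \<rho> \<in> coalgebra_structures \<longleftrightarrow> \<rho> \<in> chi_coalgebras"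
proof -
  define \<delta> where "\<delta> = coalgebra_of Y A U \<eta> \<Omega> M \<rho>"
  have \<delta>: "\<delta> \<in> coalgebra_components"
    unfolding \<delta>_def using \<rho> by (rule coalgebra_of_components)
  have r: "\<rho> y \<in> Arr B" "Dom B (\<rho> y) = F $\<^sub>o U $\<^sub>o M $\<^sub>o y" "Cod B (\<rho> y) = endo S $\<^sub>o M $\<^sub>o y"
    and d: "\<delta> y \<in> Arr A" "Dom A (\<delta> y) = U $\<^sub>o M $\<^sub>o y" "Cod A (\<delta> y) = endo C $\<^sub>o U $\<^sub>o M $\<^sub>o y"
    if "y \<in> Obj Y" for y
    using PiE_mem[OF \<rho> that] PiE_mem[OF \<delta> that] by (auto simp: hom_def)
  \<comment> \<open>Composing with \<open>\<Omega>\<close> cancels the inverse in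
    \<open>coalgebra_of\<close>; this is the hypothesis linking \<open>r\<close> and
    \<open>d\<close> in the pointwise lemmas.\<close>
  have transpose: "to_right A U \<eta> (U $\<^sub>o M $\<^sub>o y) (\<rho> y) = \<Omega> (M $\<^sub>o y) \<cdot>\<^bsub>A\<^esub> \<delta> y" if "y \<in> Obj Y" for y
    using that r[OF that] by (simp add: \<delta>_def coalgebra_of_def)
  have nat: "(endo S $\<^sub>a M $\<^sub>a f) \<cdot>\<^bsub>B\<^esub> \<rho> (Dom Y f) = \<rho> (Cod Y f) \<cdot>\<^bsub>B\<^esub> (F $\<^sub>a U $\<^sub>a M $\<^sub>a f) \<longleftrightarrow>
      (endo C $\<^sub>a U $\<^sub>a M $\<^sub>a f) \<cdot>\<^bsub>A\<^esub> \<delta> (Dom Y f) = \<delta> (Cod Y f) \<cdot>\<^bsub>A\<^esub> (U $\<^sub>a M $\<^sub>a f)"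
    if "f \<in> Arr Y" for f
    using that r d transpose by (intro naturality_iff) simp_all
  have coun: "coun S (M $\<^sub>o y) \<cdot>\<^bsub>B\<^esub> \<rho> y = \<epsilon> (M $\<^sub>o y) \<longleftrightarrow>
      coun C (U $\<^sub>o M $\<^sub>o y) \<cdot>\<^bsub>A\<^esub> \<delta> y = Ident A (U $\<^sub>o M $\<^sub>o y)" if "y \<in> Obj Y" for y
    using that r d transpose by (intro counit_law_iff) simp_all
  have comult: "comult S (M $\<^sub>o y) \<cdot>\<^bsub>B\<^esub> \<rho> y =
       (endo S $\<^sub>a \<rho> y) \<cdot>\<^bsub>B\<^esub> distr_law A B F U \<eta> \<epsilon> C S \<Omega> (M $\<^sub>o y) \<cdot>\<^bsub>B\<^esub> (F $\<^sub>a U $\<^sub>a \<rho> y)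
         \<cdot>\<^bsub>B\<^esub> (F $\<^sub>a \<eta> (U $\<^sub>o M $\<^sub>o y)) \<longleftrightarrow>
      comult C (U $\<^sub>o M $\<^sub>o y) \<cdot>\<^bsub>A\<^esub> \<delta> y = (endo C $\<^sub>a \<delta> y) \<cdot>\<^bsub>A\<^esub> \<delta> y" if "y \<in> Obj Y" for y
    using that r d transpose by (intro comult_law_iff) simp_all
  have "\<rho> \<in> chi_coalgebras \<longleftrightarrow> \<delta> \<in> coalgebra_structures"
    using nat coun comult
    by (auto simp: right_chi_coalgebra_def coalgebra_structure_def induced_comonad_def
      nat_trans_chi_iff[OF \<rho>] nat_trans_coalgebra_iff[OF \<delta>])
  then show ?thesis
    by (simp add: \<delta>_def)
qed

lemma coalgebra_of_in_structures:
  "\<rho> \<in> chi_coalgebras \<Longrightarrow> coalgebra_of Y A U \<eta> \<Omega> M \<rho> \<in> coalgebra_structures"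
  using coalgebra_structure_coalgebra_of_iff chi_coalgebras_components by blast

text \<open>The preceding equivalence is used at the family built from \<open>\<delta>\<close>,
  which \<open>coalgebra_of\<close> sends back to \<open>\<delta>\<close>.\<close>

lemma chi_coalgebra_of_in_coalgebras:
  assumes "\<delta> \<in> coalgebra_structures"
  shows "chi_coalgebra_of Y B F \<epsilon> S \<Omega> A M \<delta> \<in> chi_coalgebras"
proof -
  have \<delta>: "\<delta> \<in> coalgebra_components"
    using assms coalgebra_structures_components by blast
  show ?thesis
    using coalgebra_structure_coalgebra_of_iff[OF chi_coalgebra_of_components[OF \<delta>]] assms
    unfolding coalgebra_of_chi_coalgebra_of[OF \<delta>] by blast
qed

lemma bij_betw_coalgebra_of:
    "bij_betw (coalgebra_of Y A U \<eta> \<Omega> M) chi_coalgebras coalgebra_structures"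
  and bij_betw_chi_coalgebra_of:
    "bij_betw (chi_coalgebra_of Y B F \<epsilon> S \<Omega> A M) coalgebra_structures chi_coalgebras"
proof -
  have inverse:
    "\<forall>\<rho> \<in> chi_coalgebras. chi_coalgebra_of Y B F \<epsilon> S \<Omega> A M (coalgebra_of Y A U \<eta> \<Omega> M \<rho>) = \<rho>"
    "\<forall>\<delta> \<in> coalgebra_structures. coalgebra_of Y A U \<eta> \<Omega> M (chi_coalgebra_of Y B F \<epsilon> S \<Omega> A M \<delta>) = \<delta>"
    using chi_coalgebra_of_coalgebra_of chi_coalgebras_components
      coalgebra_of_chi_coalgebra_of coalgebra_structures_components by blast+
  have maps: "coalgebra_of Y A U \<eta> \<Omega> M ` chi_coalgebras \<subseteq> coalgebra_structures"
    "chi_coalgebra_of Y B F \<epsilon> S \<Omega> A M ` coalgebra_structures \<subseteq> chi_coalgebras"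
    using coalgebra_of_in_structures chi_coalgebra_of_in_coalgebras by blast+
  show "bij_betw (coalgebra_of Y A U \<eta> \<Omega> M) chi_coalgebras coalgebra_structures"
    using inverse maps by (rule bij_betw_byWitness)
  show "bij_betw (chi_coalgebra_of Y B F \<epsilon> S \<Omega> A M) coalgebra_structures chi_coalgebras"
    using inverse(2,1) maps(2,1) by (rule bij_betw_byWitness)
qed

section \<open>The Galois map between two lifts\<close>

text \<open>Reassociation alone: the inverse of \<open>\<Omega>\<close> is grouped with the
  transpose instead of with \<open>\<Phi>\<close>, which exposes a passage to \<open>C\<close>
  through \<open>S\<close> and a passage back through \<open>V\<close>.\<close>

lemma galois_on_eq:
  assumes "comonad_lift A B U C V \<Phi>" and \<rho>: "\<rho> \<in> chi_components"
  shows "galois_on Y A B F U \<eta> \<epsilon> \<Omega> V \<Phi> M \<rho> =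
    chi_coalgebra_of Y B F \<epsilon> V \<Phi> A M (coalgebra_of Y A U \<eta> \<Omega> M \<rho>)"
proof -
  \<comment> \<open>Supplies the typing rules for the components of \<open>\<Phi>\<close>.\<close>
  interpret V: lifted_adjunction A B F U \<eta> \<epsilon> C V \<Phi>
    using assms(1) by (intro lifted_adjunction.intro adjunction_axioms)
  show ?thesis
    using PiE_mem[OF \<rho>]
    by (auto simp: galois_on_def galois_map_def chi_coalgebra_of_def coalgebra_of_def hom_def
      F.A.Comp_arr_assoc intro!: restrict_ext)
qed

text \<open>The set \<open>coalgebra_structures\<close> refers to \<open>C\<close> but to neither
  lift, so the bijections for \<open>S\<close> and \<open>V\<close> compose through it.\<close>

lemma bij_betw_galois_on:
  assumes "comonad_lift A B U C V \<Phi>"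
  shows "bij_betw (galois_on Y A B F U \<eta> \<epsilon> \<Omega> V \<Phi> M) chi_coalgebras
    {\<rho>. right_chi_coalgebra Y B (induced_comonad B F U \<eta> \<epsilon>) V
      (distr_law A B F U \<eta> \<epsilon> C V \<Phi>) M \<rho>}"
proof -
  interpret V: lifted_adjunction_module A B F U \<eta> \<epsilon> C V \<Phi> Y M
    using assms by (intro lifted_adjunction_module.intro lifted_adjunction.intro
      adjunction_axioms M.cat_functor_axioms)
  have "galois_on Y A B F U \<eta> \<epsilon> \<Omega> V \<Phi> M \<rho> =
      (chi_coalgebra_of Y B F \<epsilon> V \<Phi> A M \<circ> coalgebra_of Y A U \<eta> \<Omega> M) \<rho>" if "\<rho> \<in> chi_coalgebras" for \<rho>
    using galois_on_eq[OF assms] that chi_coalgebras_components by auto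
  then show ?thesis
    using bij_betw_trans[OF bij_betw_coalgebra_of V.bij_betw_chi_coalgebra_of]
    by (subst bij_betw_cong)
qed

end

theorem proposition3p2:
  fixes A :: "('oa, 'ma) cat" and B :: "('ob, 'mb) cat" and Y :: "('oy, 'my) cat"
    and F :: "('oa, 'ma, 'ob, 'mb) funct" and U :: "('ob, 'mb, 'oa, 'ma) funct"
    and \<eta> :: "'oa \<Rightarrow> 'ma" and \<epsilon> :: "'ob \<Rightarrow> 'mb"
    and C :: "('oa, 'ma) comonad_data" and S :: "('ob, 'mb) comonad_data"
    and \<Omega> :: "'ob \<Rightarrow> 'ma"
    and M :: "('oy, 'my, 'ob, 'mb) funct"
  assumes "adjunction A B F U \<eta> \<epsilon>"
    and "comonad_lift A B U C S \<Omega>"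
    and "cat_functor Y B M"
  shows
    "bij_betw (coalgebra_of Y A U \<eta> \<Omega> M)
       {\<rho>. right_chi_coalgebra Y B (induced_comonad B F U \<eta> \<epsilon>) S (distr_law A B F U \<eta> \<epsilon> C S \<Omega>) M \<rho>}
       {\<delta>. coalgebra_structure Y A C (U \<circ>\<^sub>F M) \<delta>} \<and>
     (\<forall>(V :: ('ob, 'mb) comonad_data) (\<Phi> :: 'ob \<Rightarrow> 'ma). comonad_lift A B U C V \<Phi> \<longrightarrow>
       bij_betw (galois_on Y A B F U \<eta> \<epsilon> \<Omega> V \<Phi> M)
         {\<rho>. right_chi_coalgebra Y B (induced_comonad B F U \<eta> \<epsilon>) S (distr_law A B F U \<eta> \<epsilon> C S \<Omega>) M \<rho>}
         {\<rho>. right_chi_coalgebra Y B (induced_comonad B F U \<eta> \<epsilon>) V (distr_law A B F U \<eta> \<epsilon> C V \<Phi>) M \<rho>})"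
proof -
  interpret lifted_adjunction_module A B F U \<eta> \<epsilon> C S \<Omega> Y M
    using assms by (intro lifted_adjunction_module.intro lifted_adjunction.intro)
  show ?thesis
    using bij_betw_coalgebra_of bij_betw_galois_on by blast
qed

end
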